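(* Let $X$ be a regular scattered $P$-space of weight $\omega_1$. Then for every open cover $\mathcal{U}$ of $X$ there exists a partition of $X$ consisting of elementary sets which refines $\mathcal{U}$ (that is, each member of the partition is an elementary subset of $X$ contained in some member of $\mathcal{U}$).
   Context: A topological space is a $P$-space if all its $G_\delta$ subsets are open; regular spaces are assumed to be $T_1$. A space is scattered if every non-empty subspace of it has an isolated point. $X^{(\alpha)}$ denotes the $\alpha$-th Cantor--Bendixson derivative of $X$ ($X^{(0)}=X$, $X^{(\alpha+1)}$ is the set of accumulation points of the subspace $X^{(\alpha)}$, and intersections are taken at limit steps). For a scattered space $X$, the Cantor--Bendixson rank $N(X)$ is the least ordinal such that $X^{(N(X))}=\emptyset$. A clopen subset $E$ of a $P$-space is elementary if $N(E)$ is a successor ordinal and the last non-empty derivative $E^{(N(E)-1)}$ is a singleton, where derivatives are computed in $E$ with the subspace topology. *)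

theory Defs
  imports "HOL-Analysis.Analysis"
begin

unbundle cardinal_syntax

section \<open>Ordinals for indexing the derivatives of a space\<close>

text \<open>
  HOL has no type of all ordinals. The type \<open>'a ordinal\<close> consists of the ordinals below the
  successor cardinal of \<open>max \<aleph>\<^sub>0 |'a|\<close>, where cardinals are identified with initial ordinals. The
  derivatives of a scattered space on points of type \<open>'a\<close> become empty before the end of this
  segment (lemma \<open>cb_deriv_eventually_empty\<close> below), so Cantor--Bendixson ranks live here. The
  summand \<open>nat\<close> makes the successor cardinal infinite, so that every element has a successor
  even when \<open>'a\<close> is finite.
\<close>

abbreviation ordinal_rel :: "('a + nat) set rel" where
  "ordinal_rel \<equiv> cardSuc |UNIV :: ('a + nat) set|"

lemma Card_order_ordinal_rel: "Card_order (ordinal_rel :: ('a + nat) set rel)"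
  by (simp add: cardSuc_Card_order card_of_Card_order)

lemma infinite_Field_ordinal_rel: "infinite (Field (ordinal_rel :: ('a + nat) set rel))"
  by (simp add: card_of_cardSuc_finite)

typedef 'a ordinal = "Field (ordinal_rel :: ('a + nat) set rel)"
  using infinite_Field_ordinal_rel by (metis finite.emptyI ex_in_conv)

instantiation ordinal :: (type) linorder
begin

definition less_eq_ordinal :: "'a ordinal \<Rightarrow> 'a ordinal \<Rightarrow> bool" where
  "\<alpha> \<le> \<beta> \<longleftrightarrow> (Rep_ordinal \<alpha>, Rep_ordinal \<beta>) \<in> ordinal_rel"

definition less_ordinal :: "'a ordinal \<Rightarrow> 'a ordinal \<Rightarrow> bool" where
  "(\<alpha> :: 'a ordinal) < \<beta> \<longleftrightarrow> \<alpha> \<le> \<beta> \<and> \<alpha> \<noteq> \<beta>"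

lemma Well_order_ordinal_rel: "Well_order (ordinal_rel :: ('a + nat) set rel)"
  using Card_order_ordinal_rel card_order_on_well_order_on by blast

instance
proof
  let ?r = "ordinal_rel :: ('a + nat) set rel"
  have rf: "refl_on (Field ?r) ?r" and tr: "trans ?r" and an: "antisym ?r"
    and tot: "total_on (Field ?r) ?r"
    using Well_order_ordinal_rel
    by (auto simp: well_order_on_def linear_order_on_def partial_order_on_def preorder_on_def)
  fix \<alpha> \<beta> \<gamma> :: "'a ordinal"
  show refl': "\<alpha> \<le> \<alpha>"
    using rf Rep_ordinal[of \<alpha>] by (auto simp: less_eq_ordinal_def refl_on_def)
  show anti': "\<alpha> = \<beta>" if "\<alpha> \<le> \<beta>" "\<beta> \<le> \<alpha>"
    using antisymD[OF an] that unfolding less_eq_ordinal_def by (metis Rep_ordinal_inject)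
  show "(\<alpha> < \<beta>) = (\<alpha> \<le> \<beta> \<and> \<not> \<beta> \<le> \<alpha>)"
    using refl' anti' by (auto simp: less_ordinal_def)
  show "\<alpha> \<le> \<gamma>" if "\<alpha> \<le> \<beta>" "\<beta> \<le> \<gamma>"
    using transD[OF tr] that unfolding less_eq_ordinal_def by blast
  show "\<alpha> \<le> \<beta> \<or> \<beta> \<le> \<alpha>"
    using tot refl' Rep_ordinal[of \<alpha>] Rep_ordinal[of \<beta>]
    by (metis less_eq_ordinal_def Rep_ordinal_inject total_on_def)
qed

end

instance ordinal :: (type) wellorder
proof (rule wf_wellorderI)
  let ?r = "ordinal_rel :: ('a + nat) set rel"
  have "wf (?r - Id)"
    using Well_order_ordinal_rel by (auto simp: well_order_on_def)
  moreover have "{(x, y :: 'a ordinal). x < y} \<subseteq> inv_image (?r - Id) Rep_ordinal"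
    by (auto simp: less_ordinal_def less_eq_ordinal_def Rep_ordinal_inject)
  ultimately show "wf {(x, y :: 'a ordinal). x < y}"
    using wf_inv_image wf_subset by blast
qed intro_classes

definition ord_suc :: "'a ordinal \<Rightarrow> 'a ordinal" where
  "ord_suc \<alpha> = (LEAST \<beta>. \<alpha> < \<beta>)"

lemma less_ord_suc: "\<alpha> < ord_suc \<alpha>"
proof -
  have "\<exists>b \<in> Field ordinal_rel. Rep_ordinal \<alpha> \<noteq> b \<and> (Rep_ordinal \<alpha>, b) \<in> ordinal_rel"
    using infinite_Card_order_limit[OF Card_order_ordinal_rel infinite_Field_ordinal_rel Rep_ordinal]
    by blast
  then obtain \<beta> :: "'a ordinal" where "\<alpha> < \<beta>"
    by (metis Rep_ordinal_cases less_eq_ordinal_def less_ordinal_def)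
  then show ?thesis
    unfolding ord_suc_def by (rule LeastI)
qed

lemma ord_suc_le_iff: "ord_suc \<alpha> \<le> \<beta> \<longleftrightarrow> \<alpha> < \<beta>"
proof
  show "ord_suc \<alpha> \<le> \<beta> \<Longrightarrow> \<alpha> < \<beta>"
    using less_ord_suc less_le_trans by blast
  show "\<alpha> < \<beta> \<Longrightarrow> ord_suc \<alpha> \<le> \<beta>"
    unfolding ord_suc_def by (rule Least_le)
qed

lemma ord_suc_inject: "ord_suc \<alpha> = ord_suc \<beta> \<longleftrightarrow> \<alpha> = \<beta>"
proof
  assume eq: "ord_suc \<alpha> = ord_suc \<beta>"
  have "\<not> \<alpha> < \<beta>" "\<not> \<beta> < \<alpha>"
    using ord_suc_le_iff[of \<alpha> \<beta>] ord_suc_le_iff[of \<beta> \<alpha>]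
      less_ord_suc[of \<alpha>] less_ord_suc[of \<beta>] eq by auto
  then show "\<alpha> = \<beta>" by simp
qed simp

section \<open>Cantor--Bendixson derivatives\<close>

text \<open>
  At the least ordinal the else branch is an empty intersection, which is cut down to
  \<open>topspace X\<close>; at limit ordinals that cut is vacuous. So the else branch
  covers both the initial and the limit steps.
\<close>

function cb_deriv :: "'a topology \<Rightarrow> 'a ordinal \<Rightarrow> 'a set" where
  "cb_deriv X \<alpha> =
    (if \<exists>\<beta>. \<alpha> = ord_suc \<beta>
     then let S = cb_deriv X (THE \<beta>. \<alpha> = ord_suc \<beta>) in subtopology X S derived_set_of S
     else topspace X \<inter> (\<Inter>\<beta> \<in> {\<beta>. \<beta> < \<alpha>}. cb_deriv X \<beta>))"
  by auto
termination
proof (relation "inv_image {(\<beta>, \<alpha>). \<beta> < \<alpha>} snd")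
  show "wf (inv_image {(\<beta> :: 'a ordinal, \<alpha>). \<beta> < \<alpha>} snd)"
    by (intro wf_inv_image wf)
next
  fix X :: "'a topology" and \<alpha> :: "'a ordinal"
  assume "\<exists>\<beta>. \<alpha> = ord_suc \<beta>"
  then show "((X, THE \<beta>. \<alpha> = ord_suc \<beta>), X, \<alpha>) \<in> inv_image {(\<beta>, \<alpha>). \<beta> < \<alpha>} snd"
    by (auto simp: ord_suc_inject less_ord_suc)
qed auto

declare cb_deriv.simps [simp del]

lemma cb_deriv_zero: "cb_deriv X (LEAST \<alpha>. True) = topspace X"
proof -
  have least: "\<not> \<beta> < (LEAST \<alpha>. True)" for \<beta> :: "'a ordinal"
    by (simp add: not_less Least_le)
  then have "(LEAST \<alpha>. True) \<noteq> ord_suc \<beta>" for \<beta> :: "'a ordinal"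
    by (metis less_ord_suc)
  then show ?thesis
    using least by (subst cb_deriv.simps) simp
qed

lemma cb_deriv_suc:
  "cb_deriv X (ord_suc \<alpha>) = subtopology X (cb_deriv X \<alpha>) derived_set_of cb_deriv X \<alpha>"
  by (subst cb_deriv.simps) (simp add: ord_suc_inject Let_def)

lemma cb_deriv_subset_topspace: "cb_deriv X \<alpha> \<subseteq> topspace X"
  by (subst cb_deriv.simps) (auto simp: Let_def derived_set_of_subtopology in_derived_set_of)

lemma cb_deriv_limit:
  assumes "\<nexists>\<beta>. \<alpha> = ord_suc \<beta>" and "\<gamma> < \<alpha>"
  shows "cb_deriv X \<alpha> = (\<Inter>\<beta> \<in> {\<beta>. \<beta> < \<alpha>}. cb_deriv X \<beta>)"
  using assms cb_deriv_subset_topspace[of X \<gamma>] by (subst cb_deriv.simps) auto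

lemma cb_deriv_antimono: "\<beta> \<le> \<alpha> \<Longrightarrow> cb_deriv X \<alpha> \<subseteq> cb_deriv X \<beta>"
proof (induction \<alpha> rule: less_induct)
  case (less \<alpha>)
  show ?case
  proof (cases "\<beta> = \<alpha>")
    case False
    then have "\<beta> < \<alpha>" using less.prems by simp
    show ?thesis
    proof (cases "\<exists>\<gamma>. \<alpha> = ord_suc \<gamma>")
      case True
      then obtain \<gamma> where \<gamma>: "\<alpha> = ord_suc \<gamma>" by blast
      then have "\<beta> \<le> \<gamma>" using \<open>\<beta> < \<alpha>\<close> by (metis leD not_le ord_suc_le_iff)
      then have "cb_deriv X \<gamma> \<subseteq> cb_deriv X \<beta>" using less.IH \<gamma> less_ord_suc by blast
      then show ?thesis by (auto simp: \<gamma> cb_deriv_suc derived_set_of_subtopology)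
    next
      case False
      then show ?thesis using cb_deriv_limit \<open>\<beta> < \<alpha>\<close> by blast
    qed
  qed simp
qed

definition scattered_space :: "'a topology \<Rightarrow> bool" where
  "scattered_space X \<longleftrightarrow>
    (\<forall>S \<subseteq> topspace X. S \<noteq> {} \<longrightarrow> (\<exists>x \<in> S. openin (subtopology X S) {x}))"

lemma cb_deriv_eventually_empty:
  fixes X :: "'a topology"
  assumes "scattered_space X"
  shows "\<exists>\<alpha>. cb_deriv X \<alpha> = {}"
proof (rule ccontr)
  assume ne: "\<nexists>\<alpha>. cb_deriv X \<alpha> = {}"
  have "\<exists>x. x \<in> cb_deriv X \<alpha> \<and> x \<notin> cb_deriv X (ord_suc \<alpha>)" for \<alpha>
  proof -
    obtain x where "x \<in> cb_deriv X \<alpha>" and x: "openin (subtopology X (cb_deriv X \<alpha>)) {x}"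
      using assms ne cb_deriv_subset_topspace[of X \<alpha>] unfolding scattered_space_def by metis
    moreover have "x \<notin> cb_deriv X (ord_suc \<alpha>)"
      unfolding cb_deriv_suc derived_set_of_def using x by blast
    ultimately show ?thesis by blast
  qed
  then have "\<exists>f. \<forall>\<alpha>. f \<alpha> \<in> cb_deriv X \<alpha> \<and> f \<alpha> \<notin> cb_deriv X (ord_suc \<alpha>)"
    by (rule choice[OF allI])
  then obtain f where f: "\<And>\<alpha>. f \<alpha> \<in> cb_deriv X \<alpha>" "\<And>\<alpha>. f \<alpha> \<notin> cb_deriv X (ord_suc \<alpha>)"
    by blast
  have neq: "f \<alpha> \<noteq> f \<beta>" if "\<alpha> < \<beta>" for \<alpha> \<beta>
  proof -
    have "cb_deriv X \<beta> \<subseteq> cb_deriv X (ord_suc \<alpha>)"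
      using that by (intro cb_deriv_antimono) (simp add: ord_suc_le_iff)
    then show ?thesis using f(1)[of \<beta>] f(2)[of \<alpha>] by auto
  qed
  have "inj f"
  proof (rule injI, rule ccontr)
    fix \<alpha> \<beta> :: "'a ordinal"
    assume "f \<alpha> = f \<beta>" "\<alpha> \<noteq> \<beta>"
    then show False using neq[of \<alpha> \<beta>] neq[of \<beta> \<alpha>] by (metis linorder_neqE)
  qed
  let ?r = "ordinal_rel :: ('a + nat) set rel"
  have "inj_on (\<lambda>u. Inl (f (Abs_ordinal u)) :: 'a + nat) (Field ?r)"
    by (rule inj_onI) (simp add: inj_eq[OF \<open>inj f\<close>] Abs_ordinal_inject)
  then have "|Field ?r| \<le>o |UNIV :: ('a + nat) set|"
    by (intro card_of_ordLeqI) auto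
  moreover have "|UNIV :: ('a + nat) set| <o |Field ?r|"
    by (rule ordLess_ordIso_trans[OF cardSuc_greater[OF card_of_Card_order]
          ordIso_symmetric[OF card_of_Field_ordIso[OF Card_order_ordinal_rel]]])
  ultimately show False
    by (simp add: not_ordLess_ordLeq)
qed

text \<open>The rank is meaningful for scattered spaces only.\<close>

definition cb_rank :: "'a topology \<Rightarrow> 'a ordinal" where
  "cb_rank X = (LEAST \<alpha>. cb_deriv X \<alpha> = {})"

section \<open>P-spaces, elementary sets and weight\<close>

definition P_space :: "'a topology \<Rightarrow> bool" where
  "P_space X \<longleftrightarrow> (\<forall>S. gdelta_in X S \<longrightarrow> openin X S)"

definition elementary :: "'a topology \<Rightarrow> 'a set \<Rightarrow> bool" where
  "elementary X E \<longleftrightarrow>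
    openin X E \<and> closedin X E \<and> scattered_space (subtopology X E) \<and>
    (\<exists>\<alpha>. cb_rank (subtopology X E) = ord_suc \<alpha> \<and> is_singleton (cb_deriv (subtopology X E) \<alpha>))"

definition base_of :: "'a topology \<Rightarrow> 'a set set \<Rightarrow> bool" where
  "base_of X \<B> \<longleftrightarrow>
    (\<forall>V \<in> \<B>. openin X V) \<and>
    (\<forall>U x. openin X U \<and> x \<in> U \<longrightarrow> (\<exists>V \<in> \<B>. x \<in> V \<and> V \<subseteq> U))"

definition has_weight :: "'a topology \<Rightarrow> 'b rel \<Rightarrow> bool" where
  "has_weight X r \<longleftrightarrow>
    (\<exists>\<B>. base_of X \<B> \<and> ( |\<B>|, r) \<in> ordIso) \<and> (\<forall>\<B>. base_of X \<B> \<longrightarrow> r \<le>o |\<B>| )"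

abbreviation omega1 :: "nat set rel" where
  "omega1 \<equiv> cardSuc natLeq"

end

theory Submission
  imports Defs "HOL-Library.Countable_Set_Type"
begin

text \<open>
  In a regular \<open>P\<close>-space the clopen sets form a base, and a countable union of clopen sets is
  clopen. Weight \<open>\<omega>\<^sub>1\<close> lets every open family be replaced by at most \<open>\<omega>\<^sub>1\<close> many clopen sets with
  the same union; listing these in order type at most \<open>\<omega>\<^sub>1\<close> and removing from each the union of
  its countably many predecessors yields a disjoint clopen refinement
  (\<open>clopen_disjoint_refinement\<close>).

  By scatteredness every point \<open>x\<close> leaves the derivatives, and does so at a successor step, so some
  open neighbourhood \<open>E\<close> of \<open>x\<close> meets some derivative \<open>X\<^sup>(\<^sup>\<beta>\<^sup>)\<close> in \<open>{x}\<close> alone. Derivatives of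
  open subspaces are traces of derivatives of \<open>X\<close>, so every clopen subset of \<open>E\<close> that contains
  \<open>x\<close> is elementary (\<open>elementary_if_trace_singleton\<close>). Cover \<open>X\<close> by such sets \<open>E\<close> inside members
  of the given cover and pass to a disjoint clopen refinement. A piece \<open>F \<subseteq> E\<close> need not be
  elementary, but the only way it can fail is by missing the point \<open>x\<close>,
  and then \<open>F\<close> is disjoint from \<open>X\<^sup>(\<^sup>\<beta>\<^sup>)\<close>: its rank has dropped strictly. Induction on the index
  of a derivative that misses the set finishes the proof (\<open>clopen_elementary_partition\<close>).
\<close>

section \<open>Clopen sets in regular P-spaces\<close>

lemma P_space_closedin_countable_Union:
  assumes "P_space X" "countable \<K>" "\<And>K. K \<in> \<K> \<Longrightarrow> closedin X K"
  shows "closedin X (\<Union>\<K>)"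
proof -
  have "fsigma_in X (\<Union>\<K>)"
    using assms by (intro fsigma_in_Union closed_imp_fsigma_in)
  then show ?thesis
    using assms(1) unfolding fsigma_in_gdelta_in P_space_def closedin_def by simp
qed

text \<open>
  Regularity gives a decreasing sequence of closed neighbourhoods of \<open>x\<close>, each inside the
  interior of the preceding one. The intersection is closed; it is also the intersection of
  the interiors, hence a \<open>G\<^sub>\<delta>\<close> set and so open.
\<close>

lemma regular_P_space_clopen_nhd:
  assumes "regular_space X" "P_space X" "openin X U" "x \<in> U"
  obtains K where "openin X K" "closedin X K" "x \<in> K" "K \<subseteq> U"
proof -
  have nhd: "\<exists>V C. openin X V \<and> closedin X C \<and> x \<in> V \<and> V \<subseteq> C \<and> C \<subseteq> W"
    if "openin X W" "x \<in> W" for W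
    using assms(1) that unfolding neighbourhood_base_of_closedin[symmetric] neighbourhood_base_of
    by blast
  have "\<exists>W. \<forall>n::nat. (openin X (W n) \<and> x \<in> W n \<and> W n \<subseteq> U) \<and>
      (\<exists>C. closedin X C \<and> W (Suc n) \<subseteq> C \<and> C \<subseteq> W n)"
  proof (rule dependent_nat_choice)
    show "\<exists>W. openin X W \<and> x \<in> W \<and> W \<subseteq> U" using assms by blast
  next
    fix W and n :: nat
    assume "openin X W \<and> x \<in> W \<and> W \<subseteq> U"
    then show "\<exists>V. (openin X V \<and> x \<in> V \<and> V \<subseteq> U) \<and> (\<exists>C. closedin X C \<and> V \<subseteq> C \<and> C \<subseteq> W)"
      using nhd[of W] by (meson subset_trans)
  qed
  then obtain W where seq: "\<forall>n::nat. (openin X (W n) \<and> x \<in> W n \<and> W n \<subseteq> U) \<and>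
      (\<exists>C. closedin X C \<and> W (Suc n) \<subseteq> C \<and> C \<subseteq> W n)" ..
  then have W: "openin X (W n)" "x \<in> W n" "W n \<subseteq> U" for n
    by simp_all
  from seq have "\<forall>n. \<exists>C. closedin X C \<and> W (Suc n) \<subseteq> C \<and> C \<subseteq> W n"
    by simp
  then obtain C where C: "\<And>n. closedin X (C n)" "\<And>n. W (Suc n) \<subseteq> C n" "\<And>n. C n \<subseteq> W n"
    by metis
  have eq: "(\<Inter>n. W n) = (\<Inter>n. C n)"
    using C(2,3) by blast
  show ?thesis
  proof
    show "openin X (\<Inter>n. W n)"
      using assms(2) W(1) gdelta_in_Inter[of "range W" X] open_imp_gdelta_in
      unfolding P_space_def by blast
    show "closedin X (\<Inter>n. W n)"
      unfolding eq using C(1) by (intro closedin_INT) auto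
    show "x \<in> (\<Inter>n. W n)" "(\<Inter>n. W n) \<subseteq> U"
      using W(2,3) by blast+
  qed
qed

section \<open>Disjoint clopen refinements\<close>

text \<open>
  The well-order \<open>|\<K>|\<close> is an initial ordinal of size at most \<open>\<omega>\<^sub>1\<close>, so each of its proper initial
  segments is countable. This makes \<open>K - \<Union>(underS |\<K>| K)\<close> clopen, and each point of \<open>\<Union>\<K>\<close> lies
  in exactly one of these differences, the one given by the first \<open>K\<close> containing the point.
\<close>

lemma P_space_disjointify:
  assumes "P_space X" "|\<K>| \<le>o omega1"
    and clopen: "\<And>K. K \<in> \<K> \<Longrightarrow> openin X K \<and> closedin X K"
  obtains \<P> where "partition_on (\<Union>\<K>) \<P>"
    and "\<And>F. F \<in> \<P> \<Longrightarrow> openin X F \<and> closedin X F \<and> (\<exists>K \<in> \<K>. F \<subseteq> K)"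
proof -
  define r where "r = |\<K>|"
  have co: "Card_order r" and field: "Field r = \<K>"
    unfolding r_def by (rule card_of_Card_order) (rule Field_card_of)
  have wo: "Well_order r"
    using co card_order_on_well_order_on by blast
  have under: "underS r K \<subseteq> \<K>" for K
    using underS_Field field by (metis subsetI)
  have small: "countable (underS r K)" if "K \<in> \<K>" for K
  proof -
    have "|underS r K| <o omega1"
      using card_of_underS[OF co, of K] field that assms(2)
      unfolding r_def by (metis ordLess_ordLeq_trans)
    then show ?thesis
      using cardSuc_ordLeq_ordLess[OF natLeq_Card_order card_of_Card_order] countable_card_le_natLeq
      by blast
  qed
  define D where "D K = K - \<Union>(underS r K)" for K
  have D_clopen: "openin X (D K) \<and> closedin X (D K)" if "K \<in> \<K>" for K
  proof -
    have "openin X (\<Union>(underS r K))"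
      using under clopen by (intro openin_Union) blast
    moreover have "closedin X (\<Union>(underS r K))"
      using assms(1) small[OF that] under clopen
      by (intro P_space_closedin_countable_Union) blast+
    ultimately show ?thesis
      using clopen[OF that] unfolding D_def by blast
  qed
  have D_disjoint: "D K \<inter> D L = {}" if "K \<in> \<K>" "L \<in> \<K>" "K \<noteq> L" for K L
  proof -
    have "total_on \<K> r"
      using wo field by (auto simp: well_order_on_def linear_order_on_def)
    then have "K \<in> underS r L \<or> L \<in> underS r K"
      using that by (auto simp: total_on_def underS_def)
    then show ?thesis
      unfolding D_def by blast
  qed
  have D_cover: "\<exists>K \<in> \<K>. x \<in> D K" if x: "x \<in> \<Union>\<K>" for x
  proof -
    have "wf (r - Id)"
      using wo by (auto simp: well_order_on_def)
    moreover have "{K \<in> \<K>. x \<in> K} \<noteq> {}"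
      using x by blast
    ultimately obtain K where K: "K \<in> {K \<in> \<K>. x \<in> K}"
      and min: "\<And>L. (L, K) \<in> r - Id \<Longrightarrow> L \<notin> {K \<in> \<K>. x \<in> K}"
      by (rule wfE_min') blast
    have "x \<notin> L" if "L \<in> underS r K" for L
      using min[of L] that under[of K] unfolding underS_def by blast
    then show ?thesis
      using K unfolding D_def by blast
  qed
  show ?thesis
  proof
    show "partition_on (\<Union>\<K>) (D ` \<K> - {{}})"
    proof (rule partition_onI)
      show "\<Union>(D ` \<K> - {{}}) = \<Union>\<K>"
      proof
        show "\<Union>(D ` \<K> - {{}}) \<subseteq> \<Union>\<K>" unfolding D_def by blast
        show "\<Union>\<K> \<subseteq> \<Union>(D ` \<K> - {{}})"
        proof
          fix x assume "x \<in> \<Union>\<K>"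
          then obtain K where "K \<in> \<K>" "x \<in> D K" using D_cover by blast
          then show "x \<in> \<Union>(D ` \<K> - {{}})" by blast
        qed
      qed
      fix F G assume "F \<in> D ` \<K> - {{}}" "G \<in> D ` \<K> - {{}}" "F \<noteq> G"
      then obtain K L where "K \<in> \<K>" "L \<in> \<K>" "F = D K" "G = D L" "K \<noteq> L" by blast
      then show "disjnt F G"
        using D_disjoint unfolding disjnt_def by simp
    qed blast
    fix F assume "F \<in> D ` \<K> - {{}}"
    then obtain K where K: "K \<in> \<K>" "F = D K" by blast
    then have "F \<subseteq> K" unfolding D_def by blast
    then show "openin X F \<and> closedin X F \<and> (\<exists>K \<in> \<K>. F \<subseteq> K)"
      using K D_clopen by blast
  qed
qed

text \<open>
  The family is first replaced by clopen sets indexed by basic open sets, which is where the bound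
  on the size of a base enters.
\<close>

lemma clopen_disjoint_refinement:
  fixes X :: "'a topology"
  assumes "regular_space X" "P_space X"
    and base: "base_of X \<B>" "|\<B>| \<le>o omega1"
    and open_fam: "\<And>V. V \<in> \<V> \<Longrightarrow> openin X V"
  obtains \<P> where "partition_on (\<Union>\<V>) \<P>"
    and "\<And>F. F \<in> \<P> \<Longrightarrow> openin X F \<and> closedin X F \<and> (\<exists>V \<in> \<V>. F \<subseteq> V)"
proof -
  define good where "good B K \<longleftrightarrow> openin X K \<and> closedin X K \<and> B \<subseteq> K \<and> (\<exists>V \<in> \<V>. K \<subseteq> V)"
    for B K :: "'a set"
  define \<B>' where "\<B>' = {B \<in> \<B>. \<exists>K. good B K}"
  define k where "k B = (SOME K. good B K)" for B
  have k: "good B (k B)" if "B \<in> \<B>'" for B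
    using that unfolding \<B>'_def k_def by (auto intro: someI)
  have "|k ` \<B>'| \<le>o |\<B>|"
    by (rule ordLeq_transitive[OF card_of_image card_of_mono1]) (auto simp: \<B>'_def)
  then have card: "|k ` \<B>'| \<le>o omega1"
    using base(2) ordLeq_transitive by blast
  have union: "\<Union>(k ` \<B>') = \<Union>\<V>"
  proof
    show "\<Union>(k ` \<B>') \<subseteq> \<Union>\<V>"
      using k unfolding good_def by blast
    show "\<Union>\<V> \<subseteq> \<Union>(k ` \<B>')"
    proof
      fix x assume "x \<in> \<Union>\<V>"
      then obtain V where V: "V \<in> \<V>" "x \<in> V" by blast
      obtain K where K: "openin X K" "closedin X K" "x \<in> K" "K \<subseteq> V"
        using regular_P_space_clopen_nhd[OF assms(1,2) open_fam[OF V(1)] V(2)] .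
      then obtain B where B: "B \<in> \<B>" "x \<in> B" "B \<subseteq> K"
        using base(1) unfolding base_of_def by meson
      then have "B \<in> \<B>'"
        using K V unfolding \<B>'_def good_def by blast
      then show "x \<in> \<Union>(k ` \<B>')"
        using k B unfolding good_def by blast
    qed
  qed
  obtain \<P> where P: "partition_on (\<Union>(k ` \<B>')) \<P>"
    "\<And>F. F \<in> \<P> \<Longrightarrow> openin X F \<and> closedin X F \<and> (\<exists>K \<in> k ` \<B>'. F \<subseteq> K)"
    by (rule P_space_disjointify[OF assms(2) card]) (use k good_def in auto)
  show ?thesis
  proof
    show "partition_on (\<Union>\<V>) \<P>" using P(1) union by simp
    show "openin X F \<and> closedin X F \<and> (\<exists>V \<in> \<V>. F \<subseteq> V)" if F: "F \<in> \<P>" for F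
    proof -
      obtain B where B: "B \<in> \<B>'" "F \<subseteq> k B"
        using P(2)[OF F] by blast
      obtain V where "V \<in> \<V>" "k B \<subseteq> V"
        using k[OF B(1)] unfolding good_def by blast
      then show ?thesis
        using P(2)[OF F] B(2) by (meson subset_trans)
    qed
  qed
qed

lemma partition_on_Union_of_partitions:
  assumes "partition_on A \<P>" "\<And>F. F \<in> \<P> \<Longrightarrow> partition_on F (Q F)"
  shows "partition_on A (\<Union>(Q ` \<P>))"
proof (rule partition_onI)
  have Q: "\<Union>(Q F) = F" "{} \<notin> Q F" if "F \<in> \<P>" for F
    using assms(2)[OF that] by (auto simp: partition_on_def)
  have "\<Union>(\<Union>(Q ` \<P>)) = (\<Union>F \<in> \<P>. \<Union>(Q F))" by blast
  also have "\<dots> = A" using Q(1) partition_onD1[OF assms(1)] by simp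
  finally show "\<Union>(\<Union>(Q ` \<P>)) = A" .
  show "{} \<notin> \<Union>(Q ` \<P>)" using Q(2) by blast
  fix p q assume "p \<in> \<Union>(Q ` \<P>)" "q \<in> \<Union>(Q ` \<P>)" "p \<noteq> q"
  then obtain F G where FG: "F \<in> \<P>" "G \<in> \<P>" "p \<in> Q F" "q \<in> Q G" by blast
  show "disjnt p q"
  proof (cases "F = G")
    case True
    then show ?thesis
      using partition_onD2[OF assms(2)[OF FG(1)]] FG \<open>p \<noteq> q\<close> by (auto simp: pairwise_def)
  next
    case False
    then have "disjnt F G"
      using partition_onD2[OF assms(1)] FG by (auto simp: pairwise_def)
    then show ?thesis
      using Q(1) FG unfolding disjnt_def by blast
  qed
qed

section \<open>Derivatives of open subspaces and elementary sets\<close>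

lemma cb_deriv_open_subtopology:
  assumes "openin X E"
  shows "cb_deriv (subtopology X E) \<alpha> = E \<inter> cb_deriv X \<alpha>"
proof (induction \<alpha> rule: less_induct)
  case (less \<alpha>)
  show ?case
  proof (cases "\<exists>\<beta>. \<alpha> = ord_suc \<beta>")
    case True
    then obtain \<beta> where \<beta>: "\<alpha> = ord_suc \<beta>" by blast
    define S where "S = cb_deriv X \<beta>"
    have IH: "cb_deriv (subtopology X E) \<beta> = E \<inter> S"
      unfolding S_def using less.IH \<beta> less_ord_suc by blast
    \<comment> \<open>a neighbourhood of a point of \<open>E\<close> may be shrunk to lie inside \<open>E\<close>\<close>
    have "E \<inter> X derived_set_of (E \<inter> S) = E \<inter> X derived_set_of S"
    proof
      show "E \<inter> X derived_set_of (E \<inter> S) \<subseteq> E \<inter> X derived_set_of S"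
        by (auto simp: in_derived_set_of) blast
      show "E \<inter> X derived_set_of S \<subseteq> E \<inter> X derived_set_of (E \<inter> S)"
      proof
        fix x assume x: "x \<in> E \<inter> X derived_set_of S"
        have "\<exists>y. y \<noteq> x \<and> y \<in> E \<inter> S \<and> y \<in> T" if "x \<in> T" "openin X T" for T
        proof -
          have "\<exists>y. y \<noteq> x \<and> y \<in> S \<and> y \<in> E \<inter> T"
            using x that(1) openin_Int[OF assms that(2)] by (auto simp: in_derived_set_of)
          then show ?thesis by blast
        qed
        then show "x \<in> E \<inter> X derived_set_of (E \<inter> S)"
          using x by (auto simp: in_derived_set_of)
      qed
    qed
    then have "E \<inter> S \<inter> X derived_set_of (E \<inter> S) = E \<inter> (S \<inter> X derived_set_of S)"
      by blast
    then show ?thesis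
      unfolding \<beta> cb_deriv_suc IH S_def[symmetric] derived_set_of_subtopology
      by (simp add: Int_ac)
  next
    case False
    have "cb_deriv (subtopology X E) \<alpha> =
        E \<inter> topspace X \<inter> (\<Inter>\<beta> \<in> {\<beta>. \<beta> < \<alpha>}. cb_deriv (subtopology X E) \<beta>)"
      using False by (subst cb_deriv.simps) (simp add: Int_ac)
    also have "\<dots> = E \<inter> (topspace X \<inter> (\<Inter>\<beta> \<in> {\<beta>. \<beta> < \<alpha>}. cb_deriv X \<beta>))"
      using less.IH by auto
    also have "\<dots> = E \<inter> cb_deriv X \<alpha>"
      using False by (subst (2) cb_deriv.simps) simp
    finally show ?thesis .
  qed
qed

lemma scattered_space_subtopology:
  assumes "scattered_space X"
  shows "scattered_space (subtopology X E)"
  using assms unfolding scattered_space_def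
  by (simp add: subtopology_subtopology Int_absorb1)

lemma elementary_if_trace_singleton:
  assumes "scattered_space X" "openin X E" "closedin X E" "E \<inter> cb_deriv X \<beta> = {x}"
  shows "elementary X E"
proof -
  let ?Y = "subtopology X E"
  have top: "cb_deriv ?Y \<beta> = {x}"
    using cb_deriv_open_subtopology[OF assms(2)] assms(4) by blast
  have "cb_rank ?Y = ord_suc \<beta>"
    unfolding cb_rank_def
  proof (rule Least_equality)
    show "cb_deriv ?Y (ord_suc \<beta>) = {}"
      unfolding cb_deriv_suc top
      by (auto simp: derived_set_of_subtopology in_derived_set_of)
    show "ord_suc \<beta> \<le> \<gamma>" if "cb_deriv ?Y \<gamma> = {}" for \<gamma>
      using that cb_deriv_antimono[of \<gamma> \<beta> ?Y] top unfolding ord_suc_le_iff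
      by (metis not_le subset_empty insert_not_empty)
  qed
  then show ?thesis
    unfolding elementary_def
    using assms scattered_space_subtopology top by (metis is_singletonI)
qed

text \<open>
  The least derivative that misses \<open>x\<close> cannot sit at a limit step (or at the least ordinal), so it is
  the successor of some \<open>\<beta>\<close>, and \<open>x\<close> is isolated in the derivative at \<open>\<beta>\<close>.
\<close>

lemma scattered_space_isolating_nhd:
  assumes "scattered_space X" "x \<in> topspace X"
  obtains \<beta> T where "openin X T" "T \<inter> cb_deriv X \<beta> = {x}"
proof -
  define \<alpha> where "\<alpha> = (LEAST \<alpha>. x \<notin> cb_deriv X \<alpha>)"
  have "\<exists>\<alpha>. x \<notin> cb_deriv X \<alpha>"
    using cb_deriv_eventually_empty[OF assms(1)] by (metis empty_iff)
  then have out: "x \<notin> cb_deriv X \<alpha>"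
    unfolding \<alpha>_def by (rule LeastI_ex)
  have before: "x \<in> cb_deriv X \<beta>" if "\<beta> < \<alpha>" for \<beta>
    using not_less_Least that unfolding \<alpha>_def by blast
  have "\<exists>\<beta>. \<alpha> = ord_suc \<beta>"
  proof (rule ccontr)
    assume "\<nexists>\<beta>. \<alpha> = ord_suc \<beta>"
    then have "cb_deriv X \<alpha> = topspace X \<inter> (\<Inter>\<beta> \<in> {\<beta>. \<beta> < \<alpha>}. cb_deriv X \<beta>)"
      by (subst cb_deriv.simps) simp
    then show False using out before assms(2) by blast
  qed
  then obtain \<beta> where \<beta>: "\<alpha> = ord_suc \<beta>" by blast
  then have x: "x \<in> cb_deriv X \<beta>" using before less_ord_suc by blast
  then have "x \<notin> X derived_set_of cb_deriv X \<beta>"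
    using out unfolding \<beta> cb_deriv_suc derived_set_of_subtopology by simp
  then obtain T where "openin X T" "x \<in> T" "\<And>y. y \<in> T \<Longrightarrow> y \<in> cb_deriv X \<beta> \<Longrightarrow> y = x"
    using assms(2) unfolding in_derived_set_of by blast
  then show ?thesis
    using that[of T \<beta>] x by blast
qed

section \<open>Elementary partitions\<close>

text \<open>
  The induction runs over clopen subsets of a fixed space, measured by a derivative of the whole
  space that they miss, so that ranks of different subspaces never have to be compared.
\<close>

lemma clopen_elementary_partition:
  fixes X :: "'a topology"
  assumes "regular_space X" "P_space X" "scattered_space X"
    and base: "base_of X \<B>" "|\<B>| \<le>o omega1"
    and cover: "\<And>U. U \<in> \<U> \<Longrightarrow> openin X U" "topspace X \<subseteq> \<Union>\<U>"
    and C: "openin X C" "closedin X C" "C \<inter> cb_deriv X \<alpha> = {}"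
  shows "\<exists>\<P>. partition_on C \<P> \<and> (\<forall>E \<in> \<P>. elementary X E \<and> (\<exists>U \<in> \<U>. E \<subseteq> U))"
  using C
proof (induction \<alpha> arbitrary: C rule: less_induct)
  case (less \<alpha> C)
  define \<V> where "\<V> = {E. openin X E \<and> E \<subseteq> C \<and> (\<exists>U \<in> \<U>. E \<subseteq> U) \<and>
    (\<exists>\<beta> x. E \<inter> cb_deriv X \<beta> = {x})}"
  have "\<Union>\<V> = C"
  proof
    show "\<Union>\<V> \<subseteq> C" unfolding \<V>_def by blast
    show "C \<subseteq> \<Union>\<V>"
    proof
      fix x assume x: "x \<in> C"
      then have "x \<in> topspace X" using less.prems(1) openin_subset by blast
      then obtain \<beta> T U where T: "openin X T" "T \<inter> cb_deriv X \<beta> = {x}" and U: "U \<in> \<U>" "x \<in> U"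
        using scattered_space_isolating_nhd[OF assms(3)] cover(2) by (metis UnionE subsetD)
      have "C \<inter> (T \<inter> U) \<in> \<V>"
        unfolding \<V>_def using less.prems(1) T U cover(1) x
        by (intro CollectI conjI exI[of _ \<beta>] exI[of _ x] openin_Int) auto
      then show "x \<in> \<Union>\<V>" using x T U by blast
    qed
  qed
  moreover obtain \<F> where \<F>: "partition_on (\<Union>\<V>) \<F>"
    and pieces: "\<And>F. F \<in> \<F> \<Longrightarrow> openin X F \<and> closedin X F \<and> (\<exists>E \<in> \<V>. F \<subseteq> E)"
    by (rule clopen_disjoint_refinement[OF assms(1,2) base, of \<V>]) (auto simp: \<V>_def)
  ultimately have part: "partition_on C \<F>" by simp
  have "\<exists>\<P>. partition_on F \<P> \<and> (\<forall>E \<in> \<P>. elementary X E \<and> (\<exists>U \<in> \<U>. E \<subseteq> U))"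
    if F: "F \<in> \<F>" for F
  proof -
    obtain E where E: "E \<in> \<V>" "F \<subseteq> E" using pieces[OF F] by blast
    then obtain U \<beta> x where E': "E \<subseteq> C" "U \<in> \<U>" "E \<subseteq> U" "E \<inter> cb_deriv X \<beta> = {x}"
      unfolding \<V>_def by blast
    show ?thesis
    proof (cases "x \<in> F")
      case True
      then have "F \<inter> cb_deriv X \<beta> = {x}" using E' E(2) by blast
      then have "elementary X F"
        using elementary_if_trace_singleton[OF assms(3)] pieces[OF F] by blast
      moreover have "partition_on F {F}" using True by (intro partition_on_space) blast
      moreover have "F \<subseteq> U" using E(2) E'(3) by blast
      ultimately show ?thesis using E'(2) by (intro exI[of _ "{F}"]) auto
    next
      case False
      have "F \<inter> cb_deriv X \<beta> \<subseteq> {x}" using E'(4) E(2) by blast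
      then have "F \<inter> cb_deriv X \<beta> = {}" using False by auto
      \<comment> \<open>\<open>x\<close> lies in \<open>C\<close> and in the derivative at \<open>\<beta>\<close>, while \<open>C\<close> misses all derivatives from \<open>\<alpha>\<close> on\<close>
      moreover have "\<beta> < \<alpha>"
      proof (rule ccontr)
        assume "\<not> \<beta> < \<alpha>"
        then have "cb_deriv X \<beta> \<subseteq> cb_deriv X \<alpha>" by (intro cb_deriv_antimono) simp
        then have "E \<inter> cb_deriv X \<beta> \<subseteq> C \<inter> cb_deriv X \<alpha>" using E'(1) by blast
        then show False using E'(4) less.prems(3) by simp
      qed
      moreover have "openin X F" "closedin X F" using pieces[OF F] by simp_all
      ultimately show ?thesis using less.IH[of \<beta> F] by simp
    qed
  qed
  then have "\<exists>Q. \<forall>F \<in> \<F>. partition_on F (Q F) \<and>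
      (\<forall>E \<in> Q F. elementary X E \<and> (\<exists>U \<in> \<U>. E \<subseteq> U))"
    by (intro bchoice ballI)
  then obtain Q where "\<forall>F \<in> \<F>. partition_on F (Q F) \<and>
      (\<forall>E \<in> Q F. elementary X E \<and> (\<exists>U \<in> \<U>. E \<subseteq> U))" ..
  then have Q: "partition_on F (Q F)"
    "\<And>E. E \<in> Q F \<Longrightarrow> elementary X E \<and> (\<exists>U \<in> \<U>. E \<subseteq> U)" if "F \<in> \<F>" for F
    using that by simp_all
  have "partition_on C (\<Union>(Q ` \<F>))"
    using part Q(1) by (rule partition_on_Union_of_partitions)
  moreover have "\<forall>E \<in> \<Union>(Q ` \<F>). elementary X E \<and> (\<exists>U \<in> \<U>. E \<subseteq> U)"
    by (intro ballI, elim UN_E) (rule Q(2))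
  ultimately show ?case by (intro exI conjI)
qed

theorem lemma4:
  fixes X :: "'a topology"
  assumes "regular_space X" and "t1_space X"
    and "scattered_space X"
    and "P_space X"
    and "has_weight X omega1"
  shows "\<forall>\<U>. (\<forall>U \<in> \<U>. openin X U) \<and> \<Union>\<U> = topspace X \<longrightarrow>
    (\<exists>\<P>. partition_on (topspace X) \<P> \<and>
      (\<forall>E \<in> \<P>. elementary X E \<and> (\<exists>U \<in> \<U>. E \<subseteq> U)))"
proof (intro allI impI)
  fix \<U> assume \<U>: "(\<forall>U \<in> \<U>. openin X U) \<and> \<Union>\<U> = topspace X"
  obtain \<B> where \<B>: "base_of X \<B>" "|\<B>| \<le>o omega1"
    using assms(5) ordIso_imp_ordLeq unfolding has_weight_def by blast
  obtain \<alpha> where "cb_deriv X \<alpha> = {}"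
    using cb_deriv_eventually_empty[OF assms(3)] by blast
  then show "\<exists>\<P>. partition_on (topspace X) \<P> \<and>
      (\<forall>E \<in> \<P>. elementary X E \<and> (\<exists>U \<in> \<U>. E \<subseteq> U))"
    using \<U> by (intro clopen_elementary_partition[OF assms(1,4,3) \<B>, where \<alpha> = \<alpha>]) auto
qed

end
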